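(* Let $A$ be a real $m\times n$ matrix whose minimal entry is $0$ and maximal entry is $1$, let $S=(s_{kj})$ be an $n\times n$ switching-cost matrix, and let $c\ge0$. Player 2's loss from limiting himself to static strategies in the game $(A,S,c)$ satisfies $$\tilde v(c)-v(c)\ \le\ \Delta(c)=\tfrac12\,(1-v(c))+\tfrac c4\,\Xi+\tfrac c4\,M,$$ where $M=\max_{y\in\Delta(\{1,\dots,n\})}y^TSy$ and $\Xi=\max_{j,k}|s_{jk}-s_{kj}|$.
   Context: A zero-sum game with switching costs is a tuple $(A,S,c)$ where $A=(a_{ij})$ is a real $m\times n$ matrix, $c\ge 0$, and $S=(s_{kj})$ is an $n\times n$ matrix (a switching-cost matrix) with $s_{kj}\ge 0$, $s_{jj}=0$ for all $k,j$, normalized so that its smallest nonzero entry is $1$. At each stage $t=1,2,\dots$, Player 1 (the maximizer) chooses a row $i(t)$ and Player 2 (the minimizer) simultaneously chooses a column $j(t)$, possibly at random, knowing the history of realized actions. The stage payoff, paid by Player 2 to Player 1, is $u_t=a_{i(t)j(t)}+c\,s_{j(t-1)j(t)}$, with no switching cost paid at $t=1$. For a strategy pair $(\sigma,\tau)$ the payoff is $\gamma(\sigma,\tau)=\mathbb{E}_{\sigma,\tau}\big(\liminf_{T\to\infty}\frac1T\sum_{t=1}^T u_t\big)$. A stationary strategy is one in which the mixed action at stage $t$ depends only on the previous action $j(t-1)$ of Player 2 (at stage 1 a fixed arbitrary initial state $j(0)$ plays the role of the previous action). The game has a value $v(c)$, attained by stationary strategies of both players. A static strategy plays the same mixed action at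 every stage regardless of history. The minimax value in static strategies is $\tilde v(c)=\min_{y\in\Delta(\{1,\dots,n\})}\max_{x\in\Delta(\{1,\dots,m\})}\{x^TAy+c\,y^TSy\}$. *)

theory Defs
  imports "HOL-Probability.Probability"
begin

text \<open>
  The rows (actions of Player 1, the maximizer) are the elements of the finite type \<open>'m\<close>, the
  columns (actions of Player 2, the minimizer) those of the finite type \<open>'n\<close>.
  The entry \<open>S $ k $ j\<close> is the cost of switching from column \<open>k\<close> to column \<open>j\<close>.
\<close>

definition mixed_actions :: "(real ^ 'k::finite) set" where
  "mixed_actions = {x. (\<forall>i. 0 \<le> x $ i) \<and> (\<Sum>i\<in>UNIV. x $ i) = 1}"

text \<open>
  The normalization of the smallest nonzero entry only makes sense if there is a nonzero entry;
  the zero matrix (the only possibility for \<open>n = 1\<close>) is admitted.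
\<close>

definition switching_cost_matrix :: "real ^ 'n ^ 'n::finite \<Rightarrow> bool" where
  "switching_cost_matrix S \<longleftrightarrow>
     (\<forall>k j. 0 \<le> S $ k $ j) \<and> (\<forall>j. S $ j $ j = 0) \<and>
     ({S $ k $ j | k j. S $ k $ j \<noteq> 0} \<noteq> {} \<longrightarrow> Min {S $ k $ j | k j. S $ k $ j \<noteq> 0} = 1)"


section \<open>The repeated game\<close>

text \<open>
  A history is the list of the action pairs realized so far, in chronological order.
  Stages are numbered from 0, so stage \<open>t\<close> below is stage \<open>t + 1\<close> in the usual counting.
\<close>

type_synonym ('m, 'n) history = "('m \<times> 'n) list"
type_synonym ('m, 'n) strategy1 = "('m, 'n) history \<Rightarrow> 'm pmf"
type_synonym ('m, 'n) strategy2 = "('m, 'n) history \<Rightarrow> 'n pmf"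

definition stage_kernel ::
  "('m::finite, 'n::finite) strategy1 \<Rightarrow> ('m, 'n) strategy2 \<Rightarrow> nat \<Rightarrow> (nat \<Rightarrow> 'm \<times> 'n) \<Rightarrow> ('m \<times> 'n) measure"
  where
  "stage_kernel \<sigma> \<tau> t \<omega> =
     measure_pmf (pair_pmf (\<sigma> (map \<omega> [0..<t])) (\<tau> (map \<omega> [0..<t])))"

text \<open>
  The law of the infinite play is the Ionescu-Tulcea measure of these kernels. Outside of its
  locale the constant has to be written out; the lemma \<open>measure_play_cylinder\<close> below is the
  expected formula for the probability of a finite history.
\<close>

definition play_measure ::
  "('m::finite, 'n::finite) strategy1 \<Rightarrow> ('m, 'n) strategy2 \<Rightarrow> (nat \<Rightarrow> 'm \<times> 'n) measure" where
  "play_measure \<sigma> \<tau> =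
     projective_family.lim UNIV
       (Ionescu_Tulcea.CI (stage_kernel \<sigma> \<tau>) (\<lambda>_. count_space UNIV)) (\<lambda>_. count_space UNIV)"

definition stage_payoff ::
  "real ^ 'n ^ 'm \<Rightarrow> real ^ 'n ^ 'n \<Rightarrow> real \<Rightarrow> (nat \<Rightarrow> 'm::finite \<times> 'n::finite) \<Rightarrow> nat \<Rightarrow> real" where
  "stage_payoff A S c \<omega> t =
     A $ fst (\<omega> t) $ snd (\<omega> t)
       + (if t = 0 then 0 else c * S $ snd (\<omega> (t - 1)) $ snd (\<omega> t))"

text \<open>
  The averages are bounded, so the limes inferior in the extended reals is finite.
  The term for \<open>T = 0\<close> is irrelevant to it.
\<close>

definition long_run_payoff ::
  "real ^ 'n ^ 'm \<Rightarrow> real ^ 'n ^ 'n \<Rightarrow> real \<Rightarrow> (nat \<Rightarrow> 'm::finite \<times> 'n::finite) \<Rightarrow> real" where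
  "long_run_payoff A S c \<omega> =
     real_of_ereal (liminf (\<lambda>T. ereal ((\<Sum>t<T. stage_payoff A S c \<omega> t) / real T)))"

definition expected_payoff ::
  "real ^ 'n ^ 'm \<Rightarrow> real ^ 'n ^ 'n \<Rightarrow> real \<Rightarrow>
   ('m::finite, 'n::finite) strategy1 \<Rightarrow> ('m, 'n) strategy2 \<Rightarrow> real" where
  "expected_payoff A S c \<sigma> \<tau> = (LINT \<omega>|play_measure \<sigma> \<tau>. long_run_payoff A S c \<omega>)"

text \<open>
  The game has a value, i.e. the maxmin below coincides with the minmax
  \<open>INF \<tau>. SUP \<sigma>. expected_payoff A S c \<sigma> \<tau>\<close>. The maxmin is used because it is meaningful
  without appeal to that theorem; in general it is the smaller of the two, so a bound on how far
  the static minimax value lies above the maxmin also holds for the minmax.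
\<close>

definition game_value ::
  "real ^ 'n::finite ^ 'm::finite \<Rightarrow> real ^ 'n ^ 'n \<Rightarrow> real \<Rightarrow> real" where
  "game_value A S c = (SUP \<sigma>. INF \<tau>. expected_payoff A S c \<sigma> \<tau>)"


section \<open>Static strategies and the constants of the bound\<close>

text \<open>
  All suprema and infima over \<open>mixed_actions\<close> are attained, by compactness.
\<close>

definition static_value ::
  "real ^ 'n::finite ^ 'm::finite \<Rightarrow> real ^ 'n ^ 'n \<Rightarrow> real \<Rightarrow> real" where
  "static_value A S c =
     (INF y\<in>mixed_actions. SUP x\<in>mixed_actions. x \<bullet> (A *v y) + c * (y \<bullet> (S *v y)))"

definition max_static_cost :: "real ^ 'n ^ 'n::finite \<Rightarrow> real" where
  "max_static_cost S = (SUP y\<in>mixed_actions. y \<bullet> (S *v y))"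

definition asymmetry :: "real ^ 'n ^ 'n::finite \<Rightarrow> real" where
  "asymmetry S = Max {\<bar>S $ j $ k - S $ k $ j\<bar> | j k. True}"


section \<open>The law of the play\<close>

lemma PiM_count_space_finite:
  "PiM {0..<i::nat} (\<lambda>_. count_space (UNIV :: 'a::finite set)) = count_space ({0..<i} \<rightarrow>\<^sub>E UNIV)"
  by (rule count_space_PiM_finite) (auto simp: countable_finite)

lemma Ionescu_Tulcea_stage_kernel:
  fixes \<sigma> :: "('m::finite, 'n::finite) strategy1" and \<tau> :: "('m, 'n) strategy2"
  shows "Ionescu_Tulcea (stage_kernel \<sigma> \<tau>) (\<lambda>_. count_space UNIV)"
proof (rule Ionescu_Tulcea.intro)
  show "stage_kernel \<sigma> \<tau> i \<in> measurable (PiM {0..<i} (\<lambda>_. count_space UNIV))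
      (subprob_algebra (count_space UNIV))" for i
    unfolding PiM_count_space_finite
    by (auto simp: stage_kernel_def space_subprob_algebra
        intro!: prob_space_imp_subprob_space measure_pmf.prob_space_axioms)
  show "prob_space (stage_kernel \<sigma> \<tau> i x)" for i x
    by (simp add: stage_kernel_def measure_pmf.prob_space_axioms)
qed

lemma prob_space_play_measure: "prob_space (play_measure \<sigma> \<tau>)"
proof -
  interpret Ionescu_Tulcea "stage_kernel \<sigma> \<tau>" "\<lambda>_. count_space UNIV"
    by (rule Ionescu_Tulcea_stage_kernel)
  have "emeasure PF.lim (PF.emb UNIV {} {\<lambda>_. undefined}) = emeasure (CI {}) {\<lambda>_. undefined}"
    by (rule lim) (auto simp: PiM_empty)
  also have "\<dots> = 1"
    using prob_space.emeasure_space_1[OF PF.prob_space_P[of "{}"]] PF.space_P[of "{}"]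
    by (simp add: PiM_empty)
  also have "PF.emb UNIV {} {\<lambda>_. undefined} = space PF.lim"
    by (auto simp: prod_emb_def space_PiM)
  finally show ?thesis
    unfolding play_measure_def by (rule prob_spaceI)
qed

lemma measure_play_cylinder:
  fixes \<sigma> :: "('m::finite, 'n::finite) strategy1" and \<tau> :: "('m, 'n) strategy2"
  shows "measure (play_measure \<sigma> \<tau>) {\<omega>. \<forall>t<T. \<omega> t = h t} =
     (\<Prod>t<T. pmf (\<sigma> (map h [0..<t])) (fst (h t)) * pmf (\<tau> (map h [0..<t])) (snd (h t)))"
proof -
  let ?M = "\<lambda>_::nat. count_space (UNIV :: ('m \<times> 'n) set)"
  interpret Ionescu_Tulcea "stage_kernel \<sigma> \<tau>" ?M
    by (rule Ionescu_Tulcea_stage_kernel)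
  define p where "p t = pmf (\<sigma> (map h [0..<t])) (fst (h t)) * pmf (\<tau> (map h [0..<t])) (snd (h t))" for t
  define r where "r t = restrict h {0..<t}" for t
  have p0: "0 \<le> p t" for t
    by (simp add: p_def)
  have meas: "X \<in> sets (PiM {0..<t} ?M)" if "X \<subseteq> {0..<t} \<rightarrow>\<^sub>E UNIV" for X t
    using that by (simp add: PiM_count_space_finite)
  have r_in: "r t \<in> {0..<t} \<rightarrow>\<^sub>E UNIV" for t
    by (auto simp: r_def)
  have u0: "(\<lambda>_. undefined) \<in> space (PiM {0..<0} ?M)"
    by (simp add: space_PiM)
  have C: "emeasure (C 0 t (\<lambda>_. undefined)) {r t} = ennreal (\<Prod>s<t. p s)" for t
  proof (induction t)
    case 0
    then show ?case
      by (simp add: PiM_empty r_def restrict_def)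
  next
    case (Suc t)
    have step: "emeasure (eP t x) {r (Suc t)} = ennreal (p t) * indicator {r t} x"
      if x: "x \<in> {0..<t} \<rightarrow>\<^sub>E UNIV" for x
    proof -
      have "emeasure (eP t x) {r (Suc t)} =
          emeasure (stage_kernel \<sigma> \<tau> t x) ((\<lambda>y. x(t := y)) -` {r (Suc t)} \<inter> UNIV)"
        using x r_in[of "Suc t"] by (subst emeasure_eP) (auto intro!: meas simp: space_PiM)
      also have "(\<lambda>y. x(t := y)) -` {r (Suc t)} \<inter> UNIV = (if x = r t then {h t} else {})"
        using x by (auto simp: r_def fun_eq_iff restrict_def PiE_iff extensional_def
            less_Suc_eq split: if_splits)
      also have "emeasure (stage_kernel \<sigma> \<tau> t x) \<dots> = ennreal (p t) * indicator {r t} x"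
      proof (cases "x = r t")
        case True
        have m: "map (r t) [0..<t] = map h [0..<t]"
          by (auto simp: r_def)
        show ?thesis
          using True by (cases "h t") (simp add: stage_kernel_def m emeasure_pmf_single pmf_pair p_def)
      qed simp
      finally show ?thesis .
    qed
    have "emeasure (C 0 (Suc t) (\<lambda>_. undefined)) {r (Suc t)} =
        (\<integral>\<^sup>+x. emeasure (eP t x) {r (Suc t)} \<partial>C 0 t (\<lambda>_. undefined))"
      using r_in[of "Suc t"] u0 space_C[OF u0, of t]
      by (simp, subst emeasure_bind[where N="PiM {0..<Suc t} ?M"])
         (auto intro!: meas simp: space_PiM measurable_cong_sets[OF sets_C[OF u0, of t] refl])
    also have "\<dots> = (\<integral>\<^sup>+x. ennreal (p t) * indicator {r t} x \<partial>C 0 t (\<lambda>_. undefined))"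
      using space_C[OF u0, of t] by (intro nn_integral_cong step) (simp add: space_PiM)
    also have "\<dots> = ennreal (p t) * emeasure (C 0 t (\<lambda>_. undefined)) {r t}"
      using sets_C[OF u0, of t] r_in[of t]
      by (intro nn_integral_cmult_indicator) (auto intro!: meas)
    also have "\<dots> = ennreal (\<Prod>s<Suc t. p s)"
      by (simp add: Suc.IH p0 prod_nonneg ennreal_mult[symmetric] mult.commute)
    finally show ?case .
  qed
  have up: "up_to {0..<T} = T"
  proof (rule antisym)
    show "up_to {0..<T} \<le> T"
      by (simp add: up_to_iff_Ico)
    show "T \<le> up_to {0..<T}"
      using up_to[of "{0..<T}"] by (cases T) auto
  qed
  have "emeasure PF.lim (PF.emb UNIV {0..<T} {r T}) = emeasure (CI {0..<T}) {r T}"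
    using r_in by (intro lim meas) auto
  also have "CI {0..<T} = C 0 T (\<lambda>_. undefined)"
    using distr_C[of T T "\<lambda>_. undefined" 0] by (simp add: CI_def up space_PiM)
  also have "PF.emb UNIV {0..<T} {r T} = {\<omega>. \<forall>t<T. \<omega> t = h t}"
    by (auto simp: prod_emb_def r_def fun_eq_iff restrict_def) metis
  finally show ?thesis
    unfolding play_measure_def p_def[symmetric] by (simp add: measure_def C prod_nonneg p0)
qed

lemma sets_play_measure [measurable_cong]:
  "sets (play_measure \<sigma> \<tau>) = sets (PiM UNIV (\<lambda>_. count_space UNIV))"
proof -
  interpret Ionescu_Tulcea "stage_kernel \<sigma> \<tau>" "\<lambda>_. count_space UNIV"
    by (rule Ionescu_Tulcea_stage_kernel)
  show ?thesis
    unfolding play_measure_def by (rule PF.sets_lim)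
qed

lemma borel_measurable_long_run_payoff [measurable]:
  fixes A :: "real ^ 'n::finite ^ 'm::finite"
  shows "long_run_payoff A S c \<in> borel_measurable (play_measure \<sigma> \<tau>)"
proof -
  have comp [measurable]:
    "(\<lambda>\<omega>. \<omega> t) \<in> measurable (PiM UNIV (\<lambda>_. count_space UNIV)) (count_space UNIV)" for t :: nat
    by (rule measurable_component_singleton) simp
  have [measurable]: "(\<lambda>\<omega>. f (\<omega> s) (\<omega> t)) \<in> borel_measurable (PiM UNIV (\<lambda>_. count_space UNIV))"
    for f :: "('m \<times> 'n) \<Rightarrow> ('m \<times> 'n) \<Rightarrow> real" and s t :: nat
  proof (rule measurable_compose_countable[where f="\<lambda>x \<omega>. f x (\<omega> t)" and g="\<lambda>\<omega>. \<omega> s"])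
    show "(\<lambda>\<omega>. f x (\<omega> t)) \<in> borel_measurable (PiM UNIV (\<lambda>_. count_space UNIV))" for x
      by (rule measurable_compose[OF comp]) simp
  qed (rule comp)
  have "(\<lambda>\<omega>. stage_payoff A S c \<omega> t) \<in> borel_measurable (PiM UNIV (\<lambda>_. count_space UNIV))" for t
    unfolding stage_payoff_def by measurable
  note [measurable] = this
  have "long_run_payoff A S c \<in> borel_measurable (PiM UNIV (\<lambda>_. count_space UNIV))"
    unfolding long_run_payoff_def[abs_def] by measurable
  then show ?thesis
    by (simp add: measurable_cong_sets[OF sets_play_measure refl])
qed

lemma long_run_payoff_bounded:
  obtains K where "\<And>\<omega>. \<bar>long_run_payoff A S c \<omega>\<bar> \<le> K"
proof -
  define f where "f = (\<lambda>(i, k, j). \<bar>A $ i $ j\<bar> + \<bar>c * S $ k $ j\<bar>)"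
  define K where "K = Max (range f)"
  have f: "f z \<le> K" for z
    unfolding K_def by (rule Max_ge) auto
  have K0: "0 \<le> K"
    using f[of "undefined"] by (auto simp: f_def split: prod.splits intro: order_trans)
  have stage: "\<bar>stage_payoff A S c \<omega> t\<bar> \<le> K" for \<omega> t
    using f[of "(fst (\<omega> t), snd (\<omega> (t - 1)), snd (\<omega> t))"]
    by (auto simp: stage_payoff_def f_def)
  have avg: "\<bar>(\<Sum>t<T. stage_payoff A S c \<omega> t) / real T\<bar> \<le> K" for T \<omega>
  proof -
    have "\<bar>\<Sum>t<T. stage_payoff A S c \<omega> t\<bar> \<le> real T * K"
      using sum_bounded_above[of "{..<T}" "\<lambda>t. \<bar>stage_payoff A S c \<omega> t\<bar>" K] stage
      by (intro order_trans[OF sum_abs]) auto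
    then show ?thesis
      using K0 by (cases "T = 0") (auto simp: field_simps)
  qed
  have "\<bar>long_run_payoff A S c \<omega>\<bar> \<le> K" for \<omega>
  proof -
    let ?l = "liminf (\<lambda>T. ereal ((\<Sum>t<T. stage_payoff A S c \<omega> t) / real T))"
    have lo: "ereal (- K) \<le> ?l"
      using avg[of \<omega>, THEN abs_le_D2]
      by (intro Liminf_bounded always_eventually) (simp add: minus_le_iff)
    have "?l \<le> limsup (\<lambda>T. ereal ((\<Sum>t<T. stage_payoff A S c \<omega> t) / real T))"
      by (rule Liminf_le_Limsup) simp
    also have "\<dots> \<le> ereal K"
      using avg[of \<omega>, THEN abs_le_D1]
      by (intro Limsup_bounded always_eventually) simp
    finally show ?thesis
      using lo by (cases ?l) (auto simp: long_run_payoff_def)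
  qed
  then show ?thesis
    by (rule that)
qed

end

theory Submission
  imports Defs "HOL-Library.Discrete_Functions"
begin

text \<open>
  If Player 2 holds column \<open>k\<close> from the previous stage, the coming stage payoff is that of the
  one-shot matrix game with entries \<open>a\<^sub>i\<^sub>j + c s\<^sub>k\<^sub>j\<close>. Let Player 1 forget about the future and play,
  in every state \<open>k\<close>, an optimal action of this one-shot game. If all these one-shot games have
  value at least \<open>w\<close>, then every stage after the first pays at least \<open>w\<close> in conditional
  expectation, whatever Player 2 does, so the repeated game is worth at least \<open>w\<close>
  (\<open>game_value_ge_state_games\<close>). Since the payoff is the expectation of a limes inferior, bounds on
  the expected averages would not suffice: what carries this is a strong law of large numbers along
  plays (\<open>strong_law_play\<close>), which gives the lower bound \<open>w\<close> almost surely.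

  It remains to compare the static value with the one-shot games. For every state \<open>k\<close> and every
  mixed column \<open>y\<close>, the static strategy that plays half the time \<open>k\<close> and half the time \<open>y\<close> costs at
  most half of 1, plus half of what \<open>y\<close> costs in the one-shot game of state \<open>k\<close>, plus
  \<open>c / 4\<close> times the asymmetry and the maximal static switching cost
  (\<open>static_value_le_half_pure\<close>). Solving for the one-shot cost, the minimax theorem
  (\<open>minimax_matrix_game\<close>) turns this into a lower bound \<open>w\<close> on the values of all the one-shot games,
  hence on the value of the repeated game: twice the static value, minus 1, minus \<open>c / 2\<close> times those
  two constants. That \<open>w\<close> is at most the value of the repeated game is the claim rearranged.
\<close>

section \<open>Mixed actions and the minimax theorem\<close>

lemma axis_in_mixed_actions: "axis i 1 \<in> mixed_actions"
  by (auto simp: mixed_actions_def axis_def)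

lemma mixed_actions_le_1: "x \<in> mixed_actions \<Longrightarrow> x $ i \<le> 1"
  using member_le_sum[of i UNIV "\<lambda>i. x $ i"] by (auto simp: mixed_actions_def)

text \<open>
  Von Neumann's theorem by separation: the convex set of the payoff vectors that Player 2 can
  produce misses the open orthant of the vectors with all entries below \<open>w\<close>. As the orthant is
  unbounded in every negative direction, the normal vector of a separating hyperplane is
  nonnegative; scaled to a probability vector it is the required mixed action.
\<close>

lemma minimax_matrix_game:
  fixes B :: "real ^ 'n::finite ^ 'm::finite"
  assumes "\<And>y. y \<in> mixed_actions \<Longrightarrow> \<exists>i. w \<le> (B *v y) $ i"
  obtains x where "x \<in> mixed_actions" "\<And>j. w \<le> (\<Sum>i\<in>UNIV. x $ i * B $ i $ j)"
proof -
  define C where "C = (\<lambda>y. B *v y) ` mixed_actions"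
  define D where "D = {z :: real ^ 'm. \<forall>i. z $ i < w}"
  have "convex (mixed_actions :: (real ^ 'n) set)"
    by (auto simp: convex_def mixed_actions_def sum.distrib simp flip: sum_distrib_left)
  then have "convex C"
    unfolding C_def by (intro convex_linear_image) auto
  moreover have "convex D"
  proof -
    have D_eq: "D = (\<Inter>i. {z. axis i 1 \<bullet> z < w})"
      by (auto simp: D_def inner_axis')
    show ?thesis
      unfolding D_eq by (intro convex_INT convex_halfspace_lt)
  qed
  moreover have "C \<noteq> {}"
    using axis_in_mixed_actions by (auto simp: C_def)
  moreover have "D \<noteq> {}"
  proof -
    have "(\<chi> i. w - 1) \<in> D"
      by (simp add: D_def)
    then show ?thesis
      by blast
  qed
  moreover have "C \<inter> D = {}"
    using assms by (force simp: C_def D_def not_less[symmetric])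
  ultimately obtain a b where "a \<noteq> 0" and aD: "\<forall>z\<in>D. a \<bullet> z \<le> b" and aC: "\<forall>z\<in>C. b \<le> a \<bullet> z"
    using separating_hyperplane_sets[of D C] by (metis inf_commute)
  have low: "(\<Sum>i\<in>UNIV. a $ i * (w - e i)) \<le> b" if "\<And>i. e i > 0" for e
  proof -
    have "(\<chi> i. w - e i) \<in> D"
      using that by (simp add: D_def)
    then show ?thesis
      using aD by (force simp: inner_vec_def)
  qed
  \<comment> \<open>the corner of the orthant is not in it, but is a limit of its points\<close>
  have w_le: "(\<Sum>i\<in>UNIV. a $ i * w) \<le> b"
  proof (rule tendsto_upperbound)
    show "((\<lambda>e. \<Sum>i\<in>UNIV. a $ i * (w - e)) \<longlongrightarrow> (\<Sum>i\<in>UNIV. a $ i * w)) (at_right 0)"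
      by (auto intro!: tendsto_eq_intros)
    show "\<forall>\<^sub>F e in at_right 0. (\<Sum>i\<in>UNIV. a $ i * (w - e)) \<le> b"
      unfolding eventually_at_right_field using low[of "\<lambda>_. e" for e] by (intro exI[of _ 1]) auto
  qed simp
  have a0: "0 \<le> a $ i" for i
  proof (rule ccontr)
    assume neg: "\<not> 0 \<le> a $ i"
    \<comment> \<open>going far down in a coordinate with negative weight would exceed the separating level\<close>
    define R where "R = a $ i * w + (\<Sum>l\<in>UNIV - {i}. a $ l * (w - 1))"
    define r where "r = (\<bar>b - R\<bar> + 1) / - a $ i"
    have "r > 0"
      using neg unfolding r_def by (intro divide_pos_pos) auto
    have "(\<Sum>l\<in>UNIV. a $ l * (w - (if l = i then r else 1))) = - a $ i * r + R"
      by (subst sum.remove[of _ i]) (auto simp: R_def algebra_simps)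
    also have "\<dots> = \<bar>b - R\<bar> + 1 + R"
      using neg by (simp add: r_def)
    also have "\<dots> > b"
      by linarith
    finally have "b < (\<Sum>l\<in>UNIV. a $ l * (w - (if l = i then r else 1)))" .
    moreover have "(\<Sum>l\<in>UNIV. a $ l * (w - (if l = i then r else 1))) \<le> b"
      using \<open>r > 0\<close> by (intro low) simp
    ultimately show False
      by linarith
  qed
  define s where "s = (\<Sum>i\<in>UNIV. a $ i)"
  have "s > 0"
  proof -
    obtain i where "a $ i \<noteq> 0"
      using \<open>a \<noteq> 0\<close> by (auto simp: vec_eq_iff)
    then show ?thesis
      unfolding s_def using a0 by (intro sum_pos2[of _ i]) (auto simp: less_le)
  qed
  show ?thesis
  proof
    show "a /\<^sub>R s \<in> mixed_actions"
      using a0 \<open>s > 0\<close> by (auto simp: mixed_actions_def s_def simp flip: sum_distrib_left)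
    fix j
    have "s * w \<le> a \<bullet> (B *v axis j 1)"
      using w_le aC axis_in_mixed_actions[of j] by (force simp: C_def s_def sum_distrib_right)
    also have "\<dots> = (\<Sum>i\<in>UNIV. a $ i * B $ i $ j)"
      by (simp add: inner_vec_def matrix_vector_mult_basis column_def)
    finally show "w \<le> (\<Sum>i\<in>UNIV. (a /\<^sub>R s) $ i * B $ i $ j)"
      using \<open>s > 0\<close> by (simp add: field_simps mult.assoc flip: sum_divide_distrib)
  qed
qed

section \<open>Expectations over finite histories\<close>

lemma history_event [measurable]:
  "{\<omega>. map \<omega> [0..<t] = h} \<in> sets (play_measure \<sigma> \<tau>)"
proof (cases "length h = t")
  case True
  have comp [measurable]:
    "(\<lambda>\<omega>. \<omega> t) \<in> measurable (PiM UNIV (\<lambda>_. count_space UNIV)) (count_space UNIV)" for t :: nat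
    by (rule measurable_component_singleton) simp
  have "{\<omega> \<in> space (PiM UNIV (\<lambda>_. count_space UNIV)). \<forall>s<t. \<omega> s = h ! s} \<in> sets (PiM UNIV (\<lambda>_. count_space UNIV))"
    by measurable
  also have "{\<omega> \<in> space (PiM UNIV (\<lambda>_. count_space UNIV)). \<forall>s<t. \<omega> s = h ! s} = {\<omega>. map \<omega> [0..<t] = h}"
    using True by (auto simp: space_PiM list_eq_iff_nth_eq)
  finally show ?thesis
    by (simp add: sets_play_measure)
next
  case False
  then have "{\<omega>. map \<omega> [0..<t] = h} = {}"
    by auto
  then show ?thesis
    by (metis sets.empty_sets)
qed

lemma measure_history_snoc:
  assumes "length h = t"
  shows "measure (play_measure \<sigma> \<tau>) {\<omega>. map \<omega> [0..<Suc t] = h @ [a]}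
    = measure (play_measure \<sigma> \<tau>) {\<omega>. map \<omega> [0..<t] = h} * pmf (pair_pmf (\<sigma> h) (\<tau> h)) a"
proof -
  define g where "g s = (h @ [a]) ! s" for s
  have m: "map g [0..<t] = h" "g t = a"
    using assms by (auto simp: g_def list_eq_iff_nth_eq nth_append)
  have "{\<omega>. map \<omega> [0..<Suc t] = h @ [a]} = {\<omega>. \<forall>s<Suc t. \<omega> s = g s}"
    "{\<omega>. map \<omega> [0..<t] = h} = {\<omega>. \<forall>s<t. \<omega> s = g s}"
    using assms by (auto simp: m[symmetric] less_Suc_eq)
  then show ?thesis
    using m by (cases a) (simp add: measure_play_cylinder pmf_pair)
qed

text \<open>
  There are only finitely many histories of a given length, so that functions of them are simple
  functions and integrability is automatic.
\<close>

lemma has_integral_history: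
  fixes f :: "('m::finite, 'n::finite) history \<Rightarrow> real"
  shows "has_bochner_integral (play_measure \<sigma> \<tau>) (\<lambda>\<omega>. f (map \<omega> [0..<t]))
    (\<Sum>h | length h = t. f h * measure (play_measure \<sigma> \<tau>) {\<omega>. map \<omega> [0..<t] = h})"
proof -
  interpret prob_space "play_measure \<sigma> \<tau>"
    by (rule prob_space_play_measure)
  have fin: "finite {h :: ('m, 'n) history. length h = t}"
    using finite_lists_length_eq[of "UNIV :: ('m \<times> 'n) set" t] by simp
  have "f (map \<omega> [0..<t]) = (\<Sum>h | length h = t. f h * indicator {\<omega>. map \<omega> [0..<t] = h} \<omega>)" for \<omega>
    using fin by (subst sum.remove[of _ "map \<omega> [0..<t]"]) (auto intro!: sum.neutral)
  moreover have "has_bochner_integral (play_measure \<sigma> \<tau>)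
      (\<lambda>\<omega>. \<Sum>h | length h = t. f h * indicator {\<omega>. map \<omega> [0..<t] = h} \<omega>)
    (\<Sum>h | length h = t. f h * measure (play_measure \<sigma> \<tau>) {\<omega>. map \<omega> [0..<t] = h})"
    by (intro has_bochner_integral_sum has_bochner_integral_mult_right has_bochner_integral_real_indicator
        history_event) (auto simp: less_top[symmetric])
  ultimately show ?thesis
    by simp
qed

lemma integrable_history:
  fixes f :: "('m::finite, 'n::finite) history \<Rightarrow> real"
  shows "integrable (play_measure \<sigma> \<tau>) (\<lambda>\<omega>. f (map \<omega> [0..<t]))"
  using has_integral_history by (rule integrable.intros)

text \<open>
  The tower property: conditional on the history, the next pair of actions is distributed
  according to the product of the two strategies.
\<close>

lemma expectation_history_Suc:
  fixes f :: "('m::finite, 'n::finite) history \<Rightarrow> real"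
  shows "(LINT \<omega>|play_measure \<sigma> \<tau>. f (map \<omega> [0..<Suc t]))
    = (LINT \<omega>|play_measure \<sigma> \<tau>.
         (\<lambda>h. measure_pmf.expectation (pair_pmf (\<sigma> h) (\<tau> h)) (\<lambda>a. f (h @ [a]))) (map \<omega> [0..<t]))"
proof -
  let ?P = "\<lambda>t h. measure (play_measure \<sigma> \<tau>) {\<omega>. map \<omega> [0..<t] = h}"
  have E: "(LINT \<omega>|play_measure \<sigma> \<tau>. f (map \<omega> [0..<t])) = (\<Sum>h | length h = t. f h * ?P t h)" for f t
    by (rule has_bochner_integral_integral_eq[OF has_integral_history])
  have bij: "bij_betw (\<lambda>(h, a). h @ [a]) ({h. length h = t} \<times> UNIV) {h :: ('m, 'n) history. length h = Suc t}"
    by (rule bij_betwI[where g="\<lambda>h. (butlast h, last h)"]) (auto simp: length_Suc_conv_rev)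
  have "(LINT \<omega>|play_measure \<sigma> \<tau>. f (map \<omega> [0..<Suc t]))
    = (\<Sum>(h, a)\<in>{h. length h = t} \<times> UNIV. f (h @ [a]) * ?P (Suc t) (h @ [a]))"
    unfolding E by (subst sum.reindex_bij_betw[OF bij, symmetric]) (simp add: case_prod_unfold)
  also have "\<dots> = (\<Sum>h | length h = t. \<Sum>a\<in>UNIV. f (h @ [a]) * ?P (Suc t) (h @ [a]))"
    by (simp add: sum.cartesian_product)
  also have "\<dots> = (\<Sum>h | length h = t.
      measure_pmf.expectation (pair_pmf (\<sigma> h) (\<tau> h)) (\<lambda>a. f (h @ [a])) * ?P t h)"
    by (intro sum.cong refl)
       (simp add: measure_history_snoc integral_measure_pmf_real[where A=UNIV] sum_distrib_left mult_ac del: upt_Suc)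
  also have "\<dots> = (LINT \<omega>|play_measure \<sigma> \<tau>.
         (\<lambda>h. measure_pmf.expectation (pair_pmf (\<sigma> h) (\<tau> h)) (\<lambda>a. f (h @ [a]))) (map \<omega> [0..<t]))"
    by (subst E) simp
  finally show ?thesis .
qed

section \<open>A strong law of large numbers along plays\<close>

text \<open>
  A function \<open>d\<close> of the history and the pair of actions that follows it is a martingale difference
  sequence if its conditional expectation vanishes after every history. Its partial sum is taken as
  a function of the history so that the tower property applies to it.
\<close>

definition cumulated :: "('m, 'n) history \<Rightarrow> (('m, 'n) history \<Rightarrow> 'm \<times> 'n \<Rightarrow> real) \<Rightarrow> real" where
  "cumulated h d = (\<Sum>s<length h. d (take s h) (h ! s))"

lemma cumulated_snoc: "cumulated (h @ [a]) d = cumulated h d + d h a"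
  by (simp add: cumulated_def nth_append)

lemma cumulated_map: "cumulated (map \<omega> [0..<t]) d = (\<Sum>s<t. d (map \<omega> [0..<s]) (\<omega> s))"
  by (simp add: cumulated_def take_map min_def)

text \<open>
  Martingale differences are orthogonal: expanding the square of the next partial sum, the mixed
  term vanishes in conditional expectation, so every stage adds at most \<open>K\<^sup>2\<close>.
\<close>

lemma second_moment:
  fixes d :: "('m::finite, 'n::finite) history \<Rightarrow> 'm \<times> 'n \<Rightarrow> real"
  assumes bound: "\<And>h a. \<bar>d h a\<bar> \<le> K"
    and centred: "\<And>h. measure_pmf.expectation (pair_pmf (\<sigma> h) (\<tau> h)) (d h) = 0"
  shows "(LINT \<omega>|play_measure \<sigma> \<tau>. (cumulated (map \<omega> [0..<t]) d)\<^sup>2) \<le> real t * K\<^sup>2"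
proof (induction t)
  case 0
  then show ?case
    by (simp add: cumulated_def)
next
  case (Suc t)
  interpret prob_space "play_measure \<sigma> \<tau>"
    by (rule prob_space_play_measure)
  have step: "measure_pmf.expectation (pair_pmf (\<sigma> h) (\<tau> h)) (\<lambda>a. (cumulated (h @ [a]) d)\<^sup>2)
      \<le> (cumulated h d)\<^sup>2 + K\<^sup>2" for h
  proof -
    let ?E = "measure_pmf.expectation (pair_pmf (\<sigma> h) (\<tau> h))"
    have I: "integrable (measure_pmf (pair_pmf (\<sigma> h) (\<tau> h))) f" for f :: "'m \<times> 'n \<Rightarrow> real"
      by (rule integrable_measure_pmf_finite) simp
    have "?E (\<lambda>a. (cumulated (h @ [a]) d)\<^sup>2)
        = ?E (\<lambda>a. (cumulated h d)\<^sup>2 + 2 * cumulated h d * d h a + (d h a)\<^sup>2)"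
      by (simp add: cumulated_snoc power2_sum algebra_simps)
    also have "\<dots> = (cumulated h d)\<^sup>2 + ?E (\<lambda>a. (d h a)\<^sup>2)"
      by (simp add: I centred)
    also have "?E (\<lambda>a. (d h a)\<^sup>2) \<le> ?E (\<lambda>a. K\<^sup>2)"
      using bound[of h] by (intro integral_mono I abs_le_square_iff[THEN iffD1] order_trans[OF _ abs_ge_self])
    finally show ?thesis
      by simp
  qed
  have "(LINT \<omega>|play_measure \<sigma> \<tau>. (cumulated (map \<omega> [0..<Suc t]) d)\<^sup>2)
      = (LINT \<omega>|play_measure \<sigma> \<tau>. (\<lambda>h. measure_pmf.expectation (pair_pmf (\<sigma> h) (\<tau> h)) (\<lambda>a. (cumulated (h @ [a]) d)\<^sup>2)) (map \<omega> [0..<t]))"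
    by (rule expectation_history_Suc)
  also have "\<dots> \<le> (LINT \<omega>|play_measure \<sigma> \<tau>. (\<lambda>h. (cumulated h d)\<^sup>2 + K\<^sup>2) (map \<omega> [0..<t]))"
    by (intro integral_mono integrable_history step)
  also have "\<dots> = (LINT \<omega>|play_measure \<sigma> \<tau>. (cumulated (map \<omega> [0..<t]) d)\<^sup>2) + K\<^sup>2"
    using integrable_history[of \<sigma> \<tau> "\<lambda>h. (cumulated h d)\<^sup>2" t] by (simp add: prob_space)
  also have "\<dots> \<le> real (Suc t) * K\<^sup>2"
    using Suc by (simp add: algebra_simps)
  finally show ?case .
qed


text \<open>
  The second moment of the average at time \<open>T\<close> is of order \<open>1 / T\<close>, which is summable along the
  squares. A series of nonnegative functions with a finite sum of integrals converges almost surely,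
  hence its terms tend to 0.
\<close>

lemma strong_law_at_squares:
  fixes d :: "('m::finite, 'n::finite) history \<Rightarrow> 'm \<times> 'n \<Rightarrow> real"
  assumes bound: "\<And>h a. \<bar>d h a\<bar> \<le> K"
    and centred: "\<And>h. measure_pmf.expectation (pair_pmf (\<sigma> h) (\<tau> h)) (d h) = 0"
  shows "AE \<omega> in play_measure \<sigma> \<tau>. (\<lambda>n. cumulated (map \<omega> [0..<n\<^sup>2]) d / real (n\<^sup>2)) \<longlonglongrightarrow> 0"
proof -
  define X where "X n \<omega> = (cumulated (map \<omega> [0..<n\<^sup>2]) d / real (n\<^sup>2))\<^sup>2" for n \<omega>
  have int: "integrable (play_measure \<sigma> \<tau>) (X n)" for n
    unfolding X_def by (rule integrable_history)
  have le: "(LINT \<omega>|play_measure \<sigma> \<tau>. X n \<omega>) \<le> K\<^sup>2 * (1 / real n ^ 2)" for n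
  proof (cases "n = 0")
    case False
    have "(LINT \<omega>|play_measure \<sigma> \<tau>. X n \<omega>)
        = (LINT \<omega>|play_measure \<sigma> \<tau>. (cumulated (map \<omega> [0..<n\<^sup>2]) d)\<^sup>2) / real (n\<^sup>2) ^ 2"
      by (simp add: X_def power_divide)
    also have "\<dots> \<le> real (n\<^sup>2) * K\<^sup>2 / real (n\<^sup>2) ^ 2"
      by (intro divide_right_mono second_moment bound centred) auto
    finally show ?thesis
      using False by (simp add: power2_eq_square)
  qed (simp add: X_def)
  have summable: "summable (\<lambda>n. K\<^sup>2 * (1 / real n ^ 2))"
    by (intro summable_mult inverse_power_summable[of 2, where 'a=real, unfolded inverse_eq_divide]) simp
  have X0: "0 \<le> X n \<omega>" for n \<omega>
    by (simp add: X_def)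
  have "(\<integral>\<^sup>+\<omega>. (\<Sum>n. ennreal (X n \<omega>)) \<partial>play_measure \<sigma> \<tau>) = (\<Sum>n. \<integral>\<^sup>+\<omega>. ennreal (X n \<omega>) \<partial>play_measure \<sigma> \<tau>)"
    using int by (intro nn_integral_suminf) auto
  also have "\<dots> = (\<Sum>n. ennreal (LINT \<omega>|play_measure \<sigma> \<tau>. X n \<omega>))"
    using int X0 by (simp add: nn_integral_eq_integral)
  also have "\<dots> \<le> (\<Sum>n. ennreal (K\<^sup>2 * (1 / real n ^ 2)))"
    by (intro suminf_le ennreal_leI le) auto
  also have "\<dots> < \<infinity>"
    using summable by (simp add: suminf_ennreal2 less_top[symmetric])
  finally have "AE \<omega> in play_measure \<sigma> \<tau>. (\<Sum>n. ennreal (X n \<omega>)) \<noteq> \<infinity>"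
    using int by (intro nn_integral_PInf_AE) auto
  then show ?thesis
  proof eventually_elim
    case (elim \<omega>)
    then have "summable (\<lambda>n. X n \<omega>)"
      using X0 by (intro summable_suminf_not_top) auto
    then have "(\<lambda>n. sqrt (X n \<omega>)) \<longlonglongrightarrow> sqrt 0"
      by (intro tendsto_real_sqrt summable_LIMSEQ_zero)
    then show ?case
      unfolding X_def real_sqrt_abs real_sqrt_zero by (rule tendsto_rabs_zero_cancel)
  qed
qed

text \<open>
  Between two consecutive squares there are too few terms to matter: with \<open>n\<^sup>2\<close> the largest square
  up to \<open>T\<close>, the at most \<open>2 n\<close> remaining terms contribute at most \<open>2 K / n\<close> to the average.
\<close>

lemma averages_tendsto_zero_from_squares:
  fixes u :: "nat \<Rightarrow> real"
  assumes bound: "\<And>t. \<bar>u t\<bar> \<le> K"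
    and squares: "(\<lambda>n. (\<Sum>t<n\<^sup>2. u t) / real (n\<^sup>2)) \<longlonglongrightarrow> 0"
  shows "(\<lambda>T. (\<Sum>t<T. u t) / real T) \<longlonglongrightarrow> 0"
proof -
  let ?r = floor_sqrt
  have K: "0 \<le> K"
    using bound[of 0] by linarith
  have r: "filterlim ?r at_top sequentially"
    unfolding filterlim_at_top eventually_sequentially
    by (metis le_floor_sqrt_iff)
  have le: "\<bar>(\<Sum>t<T. u t) / real T\<bar> \<le> \<bar>(\<Sum>t<(?r T)\<^sup>2. u t) / real ((?r T)\<^sup>2)\<bar> + 2 * K / real (?r T)"
    if "0 < T" for T
  proof -
    define n where "n = ?r T"
    have n: "0 < n" "T \<le> n\<^sup>2 + 2 * n"
      using that Suc_floor_sqrt_power2_gt[of T] by (simp_all add: n_def power2_eq_square)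
    have n_le: "n\<^sup>2 \<le> T"
      by (simp add: n_def)
    have "(\<Sum>t<T. u t) = (\<Sum>t<n\<^sup>2. u t) + (\<Sum>t=n\<^sup>2..<T. u t)"
      using sum.atLeastLessThan_concat[of 0 "n\<^sup>2" T u] n_le by (simp add: lessThan_atLeast0)
    moreover have "\<bar>\<Sum>t=n\<^sup>2..<T. u t\<bar> \<le> real (T - n\<^sup>2) * K"
      using sum_norm_bound[of "{n\<^sup>2..<T}" u K] bound by simp
    moreover have "real (T - n\<^sup>2) * K \<le> (2 * real n) * K"
      using n n_le K by (intro mult_right_mono) (auto simp: of_nat_diff simp flip: of_nat_power)
    ultimately have "\<bar>\<Sum>t<T. u t\<bar> \<le> \<bar>\<Sum>t<n\<^sup>2. u t\<bar> + 2 * real n * K"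
      by linarith
    then have "\<bar>\<Sum>t<T. u t\<bar> / real T \<le> (\<bar>\<Sum>t<n\<^sup>2. u t\<bar> + 2 * real n * K) / real (n\<^sup>2)"
      using n n_le K by (intro frac_le) (auto simp flip: of_nat_power)
    also have "\<dots> = \<bar>(\<Sum>t<n\<^sup>2. u t) / real (n\<^sup>2)\<bar> + 2 * K / real n"
      using n n_le by (simp add: add_divide_distrib power2_eq_square)
    finally show ?thesis
      by (simp add: n_def)
  qed
  have lim: "(\<lambda>T. \<bar>(\<Sum>t<(?r T)\<^sup>2. u t) / real ((?r T)\<^sup>2)\<bar> + 2 * K / real (?r T)) \<longlonglongrightarrow> 0"
  proof -
    have "(\<lambda>n. \<bar>(\<Sum>t<n\<^sup>2. u t) / real (n\<^sup>2)\<bar> + 2 * K / real n) \<longlonglongrightarrow> \<bar>0\<bar> + 0"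
      by (intro tendsto_add tendsto_rabs squares lim_const_over_n)
    from filterlim_compose[OF this r] show ?thesis
      by simp
  qed
  show ?thesis
    by (rule Lim_null_comparison[OF eventually_sequentiallyI[of 1] lim], unfold real_norm_def, rule le) simp
qed

lemma strong_law_play:
  fixes d :: "('m::finite, 'n::finite) history \<Rightarrow> 'm \<times> 'n \<Rightarrow> real"
  assumes bound: "\<And>h a. \<bar>d h a\<bar> \<le> K"
    and centred: "\<And>h. measure_pmf.expectation (pair_pmf (\<sigma> h) (\<tau> h)) (d h) = 0"
  shows "AE \<omega> in play_measure \<sigma> \<tau>. (\<lambda>T. (\<Sum>t<T. d (map \<omega> [0..<t]) (\<omega> t)) / real T) \<longlonglongrightarrow> 0"
  using strong_law_at_squares[of d K \<sigma> \<tau>, OF bound centred]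
proof eventually_elim
  case (elim \<omega>)
  then show ?case
    by (intro averages_tendsto_zero_from_squares[where K=K] bound) (simp add: cumulated_map)
qed

section \<open>Lower bounds on the value of the repeated game\<close>

lemma expected_payoff_bounded:
  obtains K where "\<And>\<sigma> \<tau>. \<bar>expected_payoff A S c \<sigma> \<tau>\<bar> \<le> K"
proof -
  obtain K where K: "\<And>\<omega>. \<bar>long_run_payoff A S c \<omega>\<bar> \<le> K"
    by (rule long_run_payoff_bounded[of A S c]) blast
  have "\<bar>expected_payoff A S c \<sigma> \<tau>\<bar> \<le> K" for \<sigma> \<tau>
  proof -
    interpret prob_space "play_measure \<sigma> \<tau>"
      by (rule prob_space_play_measure)
    have int: "integrable (play_measure \<sigma> \<tau>) (long_run_payoff A S c)"
      using K by (intro integrable_const_bound[of _ K]) auto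
    show ?thesis
      unfolding expected_payoff_def abs_le_iff
      using integral_le_const[OF int, of K] integral_ge_const[OF int, of "- K"] K
      by (auto simp: abs_le_iff minus_le_iff)
  qed
  then show ?thesis
    by (rule that)
qed

text \<open>
  A guarantee of a single strategy bounds the value from below. Suprema and infima of real sets
  are meaningful for bounded sets only, which the uniform bound on the payoffs provides.
\<close>

lemma game_value_geI:
  assumes "\<And>\<tau>. w \<le> expected_payoff A S c \<sigma> \<tau>"
  shows "w \<le> game_value A S c"
proof -
  obtain K where K: "\<And>\<sigma> \<tau>. \<bar>expected_payoff A S c \<sigma> \<tau>\<bar> \<le> K"
    by (rule expected_payoff_bounded[of A S c]) blast
  have below: "bdd_below (range (expected_payoff A S c \<sigma>))" for \<sigma>
    using K by (intro bdd_belowI2[of _ "- K"]) (simp add: abs_le_iff minus_le_iff)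
  have "(INF \<tau>. expected_payoff A S c \<sigma> \<tau>) \<le> K" for \<sigma>
    using cINF_lower[OF below UNIV_I] K by (rule order_trans[OF _ abs_le_D1])
  then have "bdd_above (range (\<lambda>\<sigma>. INF \<tau>. expected_payoff A S c \<sigma> \<tau>))"
    by (intro bdd_aboveI2)
  moreover have "w \<le> (INF \<tau>. expected_payoff A S c \<sigma> \<tau>)"
    using assms by (intro cINF_greatest) auto
  ultimately show ?thesis
    unfolding game_value_def by (intro cSUP_upper2[OF _ UNIV_I])
qed

text \<open>
  The upper bound on the stage payoffs excludes an infinite limes inferior, which the conversion
  to a real number would send to 0.
\<close>

lemma long_run_payoff_geI:
  assumes lower: "\<And>T. 0 < T \<Longrightarrow> f T \<le> (\<Sum>t<T. stage_payoff A S c \<omega> t) / real T"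
    and lim: "f \<longlonglongrightarrow> w"
  shows "w \<le> long_run_payoff A S c \<omega>"
proof -
  let ?avg = "\<lambda>T. ereal ((\<Sum>t<T. stage_payoff A S c \<omega> t) / real T)"
  define g where "g = (\<lambda>(i, k, j). A $ i $ j + \<bar>c * S $ k $ j\<bar>)"
  have stage: "stage_payoff A S c \<omega> t \<le> Max (range g)" for t
  proof -
    have "stage_payoff A S c \<omega> t \<le> g (fst (\<omega> t), snd (\<omega> (t - 1)), snd (\<omega> t))"
      by (auto simp: stage_payoff_def g_def)
    also have "\<dots> \<le> Max (range g)"
      by (intro Max_ge) auto
    finally show ?thesis .
  qed
  have avg_le: "?avg T \<le> ereal (Max (range g))" if "0 < T" for T
    using sum_bounded_above[of "{..<T}" "stage_payoff A S c \<omega>" "Max (range g)"] stage that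
    by (simp add: field_simps)
  have "liminf ?avg \<le> limsup ?avg"
    by (rule Liminf_le_Limsup) simp
  also have "\<dots> \<le> ereal (Max (range g))"
    by (intro Limsup_bounded eventually_sequentiallyI[of 1] avg_le) auto
  finally have upper: "liminf ?avg \<le> ereal (Max (range g))" .
  have "ereal w = liminf (\<lambda>T. ereal (f T))"
    using lim by (intro lim_imp_Liminf[symmetric]) auto
  also have "\<dots> \<le> liminf ?avg"
    using lower by (intro Liminf_mono eventually_sequentiallyI[of 1]) auto
  finally show ?thesis
    using upper unfolding long_run_payoff_def by (cases "liminf ?avg") auto
qed

definition pmf_of_mixed :: "real ^ 'k::finite \<Rightarrow> 'k pmf" where
  "pmf_of_mixed x = embed_pmf (\<lambda>i. x $ i)"

lemma pmf_of_mixed: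
  assumes "x \<in> mixed_actions"
  shows "pmf (pmf_of_mixed x) i = x $ i"
  unfolding pmf_of_mixed_def
  using assms
  by (intro pmf_embed_pmf)
     (auto simp: mixed_actions_def nn_integral_count_space_finite sum_ennreal)

text \<open>
  In state \<open>k\<close>, Player 1 plays \<open>x k\<close>, which secures \<open>w\<close> in the one-shot game with the switching
  costs from \<open>k\<close>. Player 2 chooses the column without seeing the realized row, so the deviation
  of the entry of \<open>A\<close> from its mean under \<open>x k\<close> is a martingale difference for every strategy of
  Player 2, and the strong law makes it disappear from the average. The switching cost needs no
  averaging: it is determined by the state and the column.
\<close>

lemma game_value_ge_state_games:
  fixes A :: "real ^ 'n::finite ^ 'm::finite" and S :: "real ^ 'n ^ 'n"
  assumes A0: "\<And>i j. 0 \<le> A $ i $ j"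
    and mixed: "\<And>k. x k \<in> mixed_actions"
    and guarantee: "\<And>k j. w \<le> (\<Sum>i\<in>UNIV. x k $ i * A $ i $ j) + c * S $ k $ j"
  shows "w \<le> game_value A S c"
proof (rule game_value_geI)
  fix \<tau> :: "('m, 'n) strategy2"
  \<comment> \<open>at the first stage \<open>last []\<close> is some fixed pair, which serves as an arbitrary initial state\<close>
  define \<sigma> :: "('m, 'n) strategy1" where "\<sigma> h = pmf_of_mixed (x (snd (last h)))" for h
  define d :: "('m, 'n) history \<Rightarrow> 'm \<times> 'n \<Rightarrow> real" where
    "d h = (\<lambda>(i, j). A $ i $ j - (\<Sum>l\<in>UNIV. x (snd (last h)) $ l * A $ l $ j))" for h
  have centred: "measure_pmf.expectation (pair_pmf (\<sigma> h) (\<tau> h)) (d h) = 0" for h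
  proof -
    let ?y = "x (snd (last h))"
    have "measure_pmf.expectation (pair_pmf (\<sigma> h) (\<tau> h)) (d h)
        = (\<Sum>(i, j)\<in>UNIV \<times> UNIV. d h (i, j) * (?y $ i * pmf (\<tau> h) j))"
      by (subst integral_measure_pmf_real[where A=UNIV])
         (auto simp: pmf_pair \<sigma>_def pmf_of_mixed mixed intro!: sum.cong)
    also have "\<dots> = (\<Sum>j\<in>UNIV. \<Sum>i\<in>UNIV. d h (i, j) * (?y $ i * pmf (\<tau> h) j))"
      by (subst sum.swap) (simp add: sum.cartesian_product)
    also have "\<dots> = (\<Sum>j\<in>UNIV. pmf (\<tau> h) j * ((\<Sum>l\<in>UNIV. ?y $ l * A $ l $ j)
        - (\<Sum>i\<in>UNIV. ?y $ i) * (\<Sum>l\<in>UNIV. ?y $ l * A $ l $ j)))"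
    proof (intro sum.cong refl)
      fix j
      define g where "g = (\<Sum>l\<in>UNIV. ?y $ l * A $ l $ j)"
      have d_eq: "d h (i, j) = A $ i $ j - g" for i
        by (simp add: d_def g_def)
      have "(\<Sum>i\<in>UNIV. d h (i, j) * (?y $ i * pmf (\<tau> h) j))
          = (\<Sum>i\<in>UNIV. pmf (\<tau> h) j * (?y $ i * A $ i $ j) - pmf (\<tau> h) j * g * ?y $ i)"
        by (simp add: d_eq algebra_simps)
      also have "\<dots> = pmf (\<tau> h) j * g - pmf (\<tau> h) j * g * (\<Sum>i\<in>UNIV. ?y $ i)"
        by (simp only: sum_subtractf flip: sum_distrib_left g_def)
      finally show "(\<Sum>i\<in>UNIV. d h (i, j) * (?y $ i * pmf (\<tau> h) j))
          = pmf (\<tau> h) j * ((\<Sum>l\<in>UNIV. ?y $ l * A $ l $ j)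
            - (\<Sum>i\<in>UNIV. ?y $ i) * (\<Sum>l\<in>UNIV. ?y $ l * A $ l $ j))"
        unfolding g_def[symmetric] by (simp add: algebra_simps)
    qed
    also have "\<dots> = 0"
      using mixed[of "snd (last h)"] by (simp add: mixed_actions_def)
    finally show ?thesis .
  qed
  define K where "K = Max (range (\<lambda>(k, i, j). \<bar>A $ i $ j - (\<Sum>l\<in>UNIV. x k $ l * A $ l $ j)\<bar>))"
  have bound: "\<bar>d h a\<bar> \<le> K" for h a
    unfolding K_def d_def
    by (rule Max_ge) (auto intro!: image_eqI[of _ _ "(snd (last h), a)"] split: prod.splits)
  interpret prob_space "play_measure \<sigma> \<tau>"
    by (rule prob_space_play_measure)
  have "AE \<omega> in play_measure \<sigma> \<tau>. w \<le> long_run_payoff A S c \<omega>"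
    using strong_law_play[of d K \<sigma> \<tau>, OF bound centred]
  proof eventually_elim
    case (elim \<omega>)
    let ?D = "\<lambda>t. d (map \<omega> [0..<t]) (\<omega> t)"
    have later: "w + ?D t \<le> stage_payoff A S c \<omega> t" if "t \<noteq> 0" for t
    proof -
      have "snd (last (map \<omega> [0..<t])) = snd (\<omega> (t - 1))"
        using that by (simp add: last_map)
      then show ?thesis
        using that guarantee[of "snd (\<omega> (t - 1))" "snd (\<omega> t)"]
        by (simp add: stage_payoff_def d_def case_prod_unfold)
    qed
    \<comment> \<open>the first stage pays no switching cost and may fall short of \<open>w\<close>; \<open>w + K\<close> makes up for it\<close>
    have total: "(\<Sum>t<T. ?D t) + real T * w - (w + K) \<le> (\<Sum>t<T. stage_payoff A S c \<omega> t)" if "0 < T" for T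
      using that
    proof (induction T rule: nat_induct_non_zero)
      case 1
      have "0 \<le> stage_payoff A S c \<omega> 0"
        using A0 by (simp add: stage_payoff_def)
      then show ?case
        using bound[of "[]" "\<omega> 0"] by simp
    next
      case (Suc T)
      then show ?case
        using later[of T] by (simp add: algebra_simps)
    qed
    have "(\<Sum>t<T. ?D t) / real T + w - (w + K) / real T
        \<le> (\<Sum>t<T. stage_payoff A S c \<omega> t) / real T" if "0 < T" for T
    proof -
      have "(\<Sum>t<T. ?D t) / real T + w - (w + K) / real T
          = ((\<Sum>t<T. ?D t) + real T * w - (w + K)) / real T"
        using that by (simp add: add_divide_distrib diff_divide_distrib)
      also have "\<dots> \<le> (\<Sum>t<T. stage_payoff A S c \<omega> t) / real T"
        using total[OF that] by (rule divide_right_mono) simp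
      finally show ?thesis .
    qed
    moreover have "(\<lambda>T. (\<Sum>t<T. ?D t) / real T + w - (w + K) / real T) \<longlonglongrightarrow> 0 + w - 0"
      by (intro tendsto_intros elim lim_const_over_n)
    ultimately show ?case
      by (intro long_run_payoff_geI) auto
  qed
  moreover have "integrable (play_measure \<sigma> \<tau>) (long_run_payoff A S c)"
  proof -
    obtain K where "\<And>\<omega>. \<bar>long_run_payoff A S c \<omega>\<bar> \<le> K"
      by (rule long_run_payoff_bounded[of A S c]) blast
    then show ?thesis
      by (intro integrable_const_bound[of _ K]) auto
  qed
  ultimately have "w \<le> expectation (long_run_payoff A S c)"
    by (intro integral_ge_const)
  then show "w \<le> expected_payoff A S c (\<lambda>h. pmf_of_mixed (x (snd (last h)))) \<tau>"
    by (simp add: expected_payoff_def \<sigma>_def[abs_def])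
qed

section \<open>Mixing a pure column into a one-shot action\<close>

lemma le_add_asymmetry: "S $ j $ k \<le> S $ k $ j + asymmetry S"
proof -
  have "finite {\<bar>S $ j $ k - S $ k $ j\<bar> | j k. True}"
    by (rule finite_subset[of _ "range (\<lambda>(j, k). \<bar>S $ j $ k - S $ k $ j\<bar>)"]) auto
  then have "\<bar>S $ j $ k - S $ k $ j\<bar> \<le> asymmetry S"
    unfolding asymmetry_def by (intro Max_ge) auto
  then show ?thesis
    by linarith
qed

lemma static_cost_le_max:
  fixes S :: "real ^ 'n ^ 'n::finite"
  assumes S: "\<And>k j. 0 \<le> S $ k $ j" and y: "y \<in> mixed_actions"
  shows "y \<bullet> (S *v y) \<le> max_static_cost S"
  unfolding max_static_cost_def
proof (rule cSUP_upper[OF y])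
  have "v \<bullet> (S *v v) \<le> (\<Sum>i\<in>UNIV. \<Sum>j\<in>UNIV. S $ i $ j)" if v: "v \<in> mixed_actions" for v
  proof -
    have "v \<bullet> (S *v v) = (\<Sum>i\<in>UNIV. \<Sum>j\<in>UNIV. (v $ i * v $ j) * S $ i $ j)"
      by (simp add: inner_vec_def matrix_vector_mult_def sum_distrib_left mult_ac)
    also have "\<dots> \<le> (\<Sum>i\<in>UNIV. \<Sum>j\<in>UNIV. 1 * S $ i $ j)"
      using v S by (intro sum_mono mult_right_mono mult_le_one mixed_actions_le_1)
        (auto simp: mixed_actions_def)
    finally show ?thesis
      by simp
  qed
  then show "bdd_above ((\<lambda>y. y \<bullet> (S *v y)) ` mixed_actions)"
    by (intro bdd_aboveI2)
qed

text \<open>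
  The deviation: Player 2 plays the pure column \<open>k\<close> with probability one half and otherwise the
  mixed action \<open>y\<close> that is used in state \<open>k\<close>, independently at every stage. The pure half costs at
  most 1 in \<open>A\<close>. Of the four equally likely pairs of consecutive choices, \<open>k\<close> then \<open>k\<close> is free,
  \<open>k\<close> then \<open>y\<close> is what switching from state \<open>k\<close> costs, \<open>y\<close> then \<open>k\<close> costs the same up to the
  asymmetry of \<open>S\<close>, and \<open>y\<close> then \<open>y\<close> costs at most the maximal static switching cost.
\<close>

lemma static_value_le_half_pure:
  fixes A :: "real ^ 'n::finite ^ 'm::finite" and S :: "real ^ 'n ^ 'n"
  assumes A: "\<And>i j. 0 \<le> A $ i $ j" "\<And>i j. A $ i $ j \<le> 1"
    and S: "\<And>k j. 0 \<le> S $ k $ j" "\<And>k. S $ k $ k = 0"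
    and c: "0 \<le> c"
    and y: "y \<in> mixed_actions"
    and m: "\<And>i. (A *v y) $ i \<le> m"
  shows "static_value A S c \<le> 1 / 2 + 1 / 2 * (m + c * (S *v y) $ k)
    + c / 4 * asymmetry S + c / 4 * max_static_cost S"
proof -
  define z where "z = (1 / 2) *\<^sub>R axis k 1 + (1 / 2) *\<^sub>R y"
  have y0: "0 \<le> y $ j" and y1: "(\<Sum>j\<in>UNIV. y $ j) = 1" for j
    using y by (auto simp: mixed_actions_def)
  have quad0: "0 \<le> u \<bullet> (B *v v)"
    if "\<And>i. 0 \<le> u $ i" "\<And>j. 0 \<le> v $ j" "\<And>i j. 0 \<le> B $ i $ j"
    for u :: "real ^ 'a::finite" and v :: "real ^ 'b::finite" and B
    using that by (auto simp: inner_vec_def matrix_vector_mult_def intro!: sum_nonneg mult_nonneg_nonneg)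
  have z: "z \<in> mixed_actions"
    using y0 y1 by (auto simp: z_def mixed_actions_def axis_def sum.distrib simp flip: sum_divide_distrib)
  have Sk: "axis k 1 \<bullet> (S *v y) = (S *v y) $ k" "axis k 1 \<bullet> (S *v axis k 1) = 0"
    using S(2) by (simp_all add: inner_axis' matrix_vector_mult_basis column_def)
  have yS: "y \<bullet> (S *v axis k 1) \<le> (S *v y) $ k + asymmetry S"
  proof -
    have "y \<bullet> (S *v axis k 1) = (\<Sum>j\<in>UNIV. y $ j * S $ j $ k)"
      by (simp add: inner_vec_def matrix_vector_mult_basis column_def)
    also have "\<dots> \<le> (\<Sum>j\<in>UNIV. y $ j * (S $ k $ j + asymmetry S))"
      by (intro sum_mono mult_left_mono le_add_asymmetry y0)
    also have "\<dots> = (S *v y) $ k + asymmetry S"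
      using y1 by (simp add: matrix_vector_mult_def algebra_simps sum.distrib flip: sum_distrib_left)
    finally show ?thesis .
  qed
  have cost: "z \<bullet> (S *v z) \<le> (S *v y) $ k / 2 + asymmetry S / 4 + max_static_cost S / 4"
  proof -
    have "z \<bullet> (S *v z) = (axis k 1 \<bullet> (S *v axis k 1) + axis k 1 \<bullet> (S *v y) + y \<bullet> (S *v axis k 1) + y \<bullet> (S *v y)) / 4"
      by (simp add: z_def matrix_vector_right_distrib inner_add_left inner_add_right
          matrix_vector_mult_scaleR field_simps)
    then show ?thesis
      using Sk yS static_cost_le_max[OF S(1) y] by simp
  qed
  have mono: "v \<bullet> (A *v z) \<le> 1 / 2 + m / 2" if v: "v \<in> mixed_actions" for v
  proof -
    have "v \<bullet> (A *v z) = (\<Sum>i\<in>UNIV. v $ i * (A $ i $ k / 2 + (A *v y) $ i / 2))"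
      by (simp add: z_def inner_vec_def matrix_vector_right_distrib matrix_vector_mult_scaleR
          matrix_vector_mult_basis column_def)
    also have "\<dots> \<le> (\<Sum>i\<in>UNIV. v $ i * (1 / 2 + m / 2))"
      using v A(2)[of _ k] m by (intro sum_mono mult_left_mono) (auto simp: mixed_actions_def intro!: add_mono)
    also have "\<dots> = 1 / 2 + m / 2"
      using v by (simp add: mixed_actions_def flip: sum_distrib_right)
    finally show ?thesis .
  qed
  \<comment> \<open>nonnegativity is what makes the infimum over the static strategies a lower bound of each of them\<close>
  let ?F = "\<lambda>u. SUP v\<in>mixed_actions. v \<bullet> (A *v u) + c * (u \<bullet> (S *v u))"
  have F0: "0 \<le> ?F u" if u: "u \<in> mixed_actions" for u
  proof -
    have u0: "0 \<le> u $ i" for i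
      using u by (simp add: mixed_actions_def)
    have "v \<bullet> (A *v u) \<le> 1" if v: "v \<in> mixed_actions" for v
    proof -
      have "v \<bullet> (A *v u) = (\<Sum>i\<in>UNIV. v $ i * (\<Sum>j\<in>UNIV. A $ i $ j * u $ j))"
        by (simp add: inner_vec_def matrix_vector_mult_def)
      also have "\<dots> \<le> (\<Sum>i\<in>UNIV. v $ i * (\<Sum>j\<in>UNIV. 1 * u $ j))"
        using v u0 A(2) by (intro sum_mono mult_left_mono mult_right_mono) (auto simp: mixed_actions_def)
      also have "\<dots> = 1"
        using u v by (simp add: mixed_actions_def)
      finally show ?thesis .
    qed
    then have "bdd_above ((\<lambda>v. v \<bullet> (A *v u) + c * (u \<bullet> (S *v u))) ` mixed_actions)"
      by (intro bdd_aboveI2[of _ _ "1 + c * (u \<bullet> (S *v u))"]) auto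
    moreover have "0 \<le> axis i 1 \<bullet> (A *v u) + c * (u \<bullet> (S *v u))" for i
      using u0 A S c by (intro add_nonneg_nonneg mult_nonneg_nonneg quad0) (auto simp: axis_def)
    ultimately show ?thesis
      by (intro cSUP_upper2[OF _ axis_in_mixed_actions])
  qed
  have "static_value A S c \<le> ?F z"
    unfolding static_value_def using F0 by (intro cINF_lower z bdd_belowI2[of _ 0])
  also have "\<dots> \<le> 1 / 2 + m / 2 + c * (z \<bullet> (S *v z))"
    using axis_in_mixed_actions by (intro cSUP_least) (auto intro!: mono)
  also have "\<dots> \<le> 1 / 2 + m / 2 + c * ((S *v y) $ k / 2 + asymmetry S / 4 + max_static_cost S / 4)"
    using cost c by (intro add_left_mono mult_left_mono) auto
  finally show ?thesis
    by (simp add: algebra_simps)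
qed

section \<open>The loss from static strategies\<close>

theorem proposition4:
  fixes A :: "real ^ 'n::finite ^ 'm::finite"
    and S :: "real ^ 'n ^ 'n"
    and c :: real
  assumes "Min {A $ i $ j | i j. True} = 0"
    and "Max {A $ i $ j | i j. True} = 1"
    and "switching_cost_matrix S"
    and "c \<ge> 0"
  shows "static_value A S c - game_value A S c
    \<le> 1 / 2 * (1 - game_value A S c) + c / 4 * asymmetry S + c / 4 * max_static_cost S"
proof -
  have fin: "finite {A $ i $ j | i j. True}"
    by (rule finite_subset[of _ "range (\<lambda>(i, j). A $ i $ j)"]) auto
  have A: "0 \<le> A $ i $ j" "A $ i $ j \<le> 1" for i j
    using Min_le[OF fin, of "A $ i $ j"] Max_ge[OF fin, of "A $ i $ j"] assms(1,2) by auto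
  have S: "0 \<le> S $ k $ j" "S $ k $ k = 0" for k j
    using assms(3) by (auto simp: switching_cost_matrix_def)
  \<comment> \<open>the level for which \<open>w \<le> game_value A S c\<close> is the claim\<close>
  define w where "w = 2 * static_value A S c - 1 - c / 2 * asymmetry S - c / 2 * max_static_cost S"
  define B where "B k = (\<chi> i j. A $ i $ j + c * S $ k $ j)" for k
  have "\<exists>i. w \<le> (B k *v y) $ i" if y: "y \<in> mixed_actions" for k y
  proof -
    define m where "m = Max (range (\<lambda>i. (A *v y) $ i))"
    have "m \<in> range (\<lambda>i. (A *v y) $ i)"
      unfolding m_def by (rule Max_in) auto
    then obtain i where i: "m = (A *v y) $ i"
      by auto
    have "(A *v y) $ l \<le> m" for l
      by (simp add: m_def)
    then have "w \<le> m + c * (S *v y) $ k"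
      using static_value_le_half_pure[OF A S assms(4) y, of m k] by (simp add: w_def field_simps)
    also have "\<dots> = (B k *v y) $ i"
      by (simp add: i B_def matrix_vector_mult_def algebra_simps sum.distrib sum_distrib_left)
    finally show ?thesis
      by blast
  qed
  then have "\<exists>x. x \<in> mixed_actions \<and> (\<forall>j. w \<le> (\<Sum>i\<in>UNIV. x $ i * B k $ i $ j))" for k
    by (metis minimax_matrix_game)
  then obtain x where x: "\<And>k. x k \<in> mixed_actions"
    and guarantee: "\<And>k j. w \<le> (\<Sum>i\<in>UNIV. x k $ i * B k $ i $ j)"
    by metis
  have "w \<le> game_value A S c"
  proof (rule game_value_ge_state_games[where x=x])
    show "w \<le> (\<Sum>i\<in>UNIV. x k $ i * A $ i $ j) + c * S $ k $ j" for k j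
      using guarantee[of k j] x[of k]
      by (simp add: B_def mixed_actions_def distrib_left sum.distrib flip: sum_distrib_right)
  qed (use A x in auto)
  then show ?thesis
    by (simp add: w_def field_simps)
qed

end
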